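(* Let $f:\mathbb{R}^N\to\mathbb{R}^N$ be the piecewise-linear continuous map with switching manifold $\Sigma$ given in the context, and let $\mathcal{X}$ and $\mathcal{Y}$ be words in $\{L,R\}$ of lengths $n$ and $p$. Suppose: (i) $\mathcal{X}\mathcal{Y} = (\mathcal{Y}\mathcal{X})^{\overline{0}\,\overline{\alpha}}$ for some $\alpha\in\{1,\ldots,n+p-1\}$; (ii) $M_{\mathcal{X}}$ has eigenvalues $\lambda_1,\lambda_2$ of multiplicity one such that, with $\beta$ denoting the maximum modulus of the remaining eigenvalues of $M_{\mathcal{X}}$, $0\le\beta<\lambda_2<1<\lambda_1$; and $e_1^{\mathsf T}\zeta_1\neq 0$; (iii) the $\mathcal{X}$-cycle $\{x_i^{\mathcal{X}}\}$ is admissible with $x_0^{\mathcal{X}}\notin\Sigma$; (iv) there exists an admissible $\mathcal{S}$-orbit $\{y_i\}_{i\in\mathbb{Z}}$, where $\mathcal{S}=\mathcal{X}^\infty\mathcal{Y}\mathcal{X}^\infty$, that is homoclinic to the $\mathcal{X}$-cycle and with $y_0=E^u(x_0^{\mathcal{X}})\cap\Sigma$ and $y_\alpha\in\Sigma$. Then $$W^u_{\rm br}\left(\{x_i^{\mathcal{X}}\}\right)=\bigcup_{i\in\mathbb{Z}}\mathcal{L}[y_i,y_{i+n})\subset W^s\left(\{x_i^{\mathcal{X}}\}\right),$$ where $W^u_{\rm br}(\{x_i^{\mathcal{X}}\})$ denotes the branch of the unstable manifold $W^u(\{x_i^{\mathcal{X}}\})$ of the $\mathcal{X}$-cycle that contains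 the $\mathcal{S}$-orbit $\{y_i\}$.
   Context: **The map.** $f(x)=f_L(x)=A_Lx+b$ if $e_1^{\mathsf T}x\le 0$ and $f(x)=f_R(x)=A_Rx+b$ if $e_1^{\mathsf T}x\ge 0$, where $A_L,A_R$ are real $N\times N$ matrices, $b\in\mathbb{R}^N$, $e_i$ is the $i$-th coordinate vector of $\mathbb{R}^N$, and $A_R=A_L+\xi e_1^{\mathsf T}$ for some $\xi\in\mathbb{R}^N$ (so $f$ is continuous; it need not be invertible). $\Sigma=\{x\in\mathbb{R}^N: e_1^{\mathsf T}x=0\}$. **Words.** A word of length $m$ is $\mathcal{Z}=\mathcal{Z}_0\cdots\mathcal{Z}_{m-1}$ with $\mathcal{Z}_i\in\{L,R\}$. Juxtaposition is concatenation. $\mathcal{Z}^{\overline{i}\,\overline{j}}$ is $\mathcal{Z}$ with the symbols at indices $i$ and $j$ flipped ($L\leftrightarrow R$). **Compositions.** For a word $\mathcal{Z}$ of length $m$: $f_{\mathcal{Z}}=f_{\mathcal{Z}_{m-1}}\circ\cdots\circ f_{\mathcal{Z}_0}$ and $M_{\mathcal{Z}}=A_{\mathcal{Z}_{m-1}}\cdots A_{\mathcal{Z}_0}$ (the linear part of the affine map $f_{\mathcal{Z}}$). **Following, cycles.** With $x_{i+1}=f(x_i)$, a point $x_0$ follows $\mathcal{Z}$ under $f$ if for all $i=0,\ldots,m-1$: $\mathcal{Z}_i=L$ whenever $e_1^{\mathsf T}x_i<0$, and $\mathcal{Z}_i=R$ whenever $e_1^{\mathsf T}x_i>0$. A $\mathcal{Z}$-cycle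 is an $m$-tuple $\{x_i^{\mathcal{Z}}\}_{i=0}^{m-1}$ with $f_{\mathcal{Z}_i}(x_i^{\mathcal{Z}})=x_{(i+1)\bmod m}^{\mathcal{Z}}$ for all $i$. It is admissible if $x_0^{\mathcal{Z}}$ follows $\mathcal{Z}$ under $f$. The $\mathcal{X}$-cycle is unique since $1$ is not an eigenvalue of $M_{\mathcal{X}}$. **Orbits.** $\mathcal{S}=\mathcal{X}^\infty\mathcal{Y}\mathcal{X}^\infty$ is the bi-infinite sequence with $\mathcal{S}_i=\mathcal{X}_{i\bmod n}$ for $i<0$, $\mathcal{S}_i=\mathcal{Y}_i$ for $0\le i\le p-1$, $\mathcal{S}_i=\mathcal{X}_{(i-p)\bmod n}$ for $i\ge p$, where $i\bmod n\in\{0,\ldots,n-1\}$. An $\mathcal{S}$-orbit is a sequence $\{y_i\}_{i\in\mathbb{Z}}$ with $y_{i+1}=f_{\mathcal{S}_i}(y_i)$ for all $i\in\mathbb{Z}$. It is admissible if for all $i\in\mathbb{Z}$: $\mathcal{S}_i=L$ whenever $e_1^{\mathsf T}y_i<0$ and $\mathcal{S}_i=R$ whenever $e_1^{\mathsf T}y_i>0$. It is homoclinic to the $\mathcal{X}$-cycle if $y_i$ converges to the $\mathcal{X}$-cycle (distance to the set of its points tends to $0$) as $i\to\infty$ and as $i\to-\infty$. **Eigenvectors and invariant subspaces.** For $i=1,2$, $\omega_i^{\mathsf T}$ and $\zeta_i$ are (real) left and right eigenvectors of $M_{\mathcal{X}}$ for $\lambda_i$, normalised so that $\omega_i^{\mathsf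 T}\zeta_i=1$. If $N=2$, $\beta=0$. $E^u(x_0^{\mathcal{X}})$ is the unstable manifold of the fixed point $x_0^{\mathcal{X}}$ of the affine map $f_{\mathcal{X}}$, i.e. the line $\{x_0^{\mathcal{X}}+a\zeta_1: a\in\mathbb{R}\}$; since $e_1^{\mathsf T}\zeta_1\ne0$, it meets $\Sigma$ in a single point. **Segments and manifolds.** $\mathcal{L}[y,z)=\{(1-s)y+sz: 0\le s<1\}$ and $\mathcal{L}(y,z)=\{(1-s)y+sz:0<s<1\}$. $W^s(\{x_i^{\mathcal{X}}\})$ is the set of points whose forward orbit under $f$ converges to the $\mathcal{X}$-cycle. The unstable manifold $W^u(\{x_i^{\mathcal{X}}\})$ of the $\mathcal{X}$-cycle under $f$ is one-dimensional and near $x_0^{\mathcal{X}}$ emanates along $E^u(x_0^{\mathcal{X}})$; it has two branches, emanating in the two opposite directions $\pm\zeta_1$ from $x_0^{\mathcal{X}}$. Each branch is the union of all forward images of a sufficiently short initial segment: the branch containing $\{y_i\}$ is $W^u_{\rm br}(\{x_i^{\mathcal{X}}\})=\bigcup_{i\ge 0}f^i\left(\mathcal{L}(x_0^{\mathcal{X}},z)\right)$ for any $z\in E^u(x_0^{\mathcal{X}})$, $z\ne x_0^{\mathcal{X}}$, lying on the same side of $x_0^{\mathcal{X}}$ as $y_0$ and sufficiently close to $x_0^{\mathcal{X}}$. *)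

theory Defs
  imports "HOL-Analysis.Analysis" "HOL-Computational_Algebra.Polynomial"
begin

text \<open>
  The space $R^N$ is \<open>real ^ 'n\<close>. Its index type carries no order, so the index of the first
  coordinate is an explicit parameter \<open>k :: 'n\<close>; the vector $e_1$ is \<open>axis k 1\<close> and
  $e_1^T x$ is \<open>x $ k\<close>. The matrices $A_L$ and $A_R$ are \<open>A L\<close> and \<open>A R\<close>.
\<close>

datatype letter = L | R

fun flip :: "letter \<Rightarrow> letter" where
  "flip L = R"
| "flip R = L"

definition flip_at :: "nat \<Rightarrow> letter list \<Rightarrow> letter list" where
  "flip_at i Z = Z[i := flip (Z ! i)]"

definition switching_manifold :: "'n::finite \<Rightarrow> (real ^ 'n) set" where
  "switching_manifold k = {x. x $ k = 0}"

definition outer :: "real ^ 'n \<Rightarrow> real ^ 'n \<Rightarrow> real ^ 'n ^ 'n::finite" where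
  "outer u v = (\<chi> i j. u $ i * v $ j)"

definition f_aff :: "(letter \<Rightarrow> real ^ 'n ^ 'n) \<Rightarrow> real ^ 'n \<Rightarrow> letter \<Rightarrow> real ^ 'n \<Rightarrow> real ^ 'n::finite" where
  "f_aff A b s x = A s *v x + b"

definition pwl :: "(letter \<Rightarrow> real ^ 'n ^ 'n) \<Rightarrow> real ^ 'n \<Rightarrow> 'n \<Rightarrow> real ^ 'n \<Rightarrow> real ^ 'n::finite" where
  "pwl A b k x = (if x $ k \<le> 0 then f_aff A b L x else f_aff A b R x)"

text \<open>Under the continuity condition both branches agree on the switching manifold.\<close>

lemma pwl_R:
  assumes "A R = A L + outer \<xi> (axis k 1)" and "x $ k \<ge> 0"
  shows "pwl A b k x = f_aff A b R x"
proof (cases "x $ k = 0")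
  case True
  have "outer \<xi> (axis k 1) *v x = 0"
    using True
    by (auto simp: outer_def matrix_vector_mult_def axis_def vec_eq_iff intro!: sum.neutral)
  then show ?thesis
    using True assms(1) by (simp add: pwl_def f_aff_def matrix_vector_mult_add_rdistrib)
next
  case False
  then show ?thesis
    using assms(2) by (simp add: pwl_def)
qed

text \<open>The first letter of a word acts first: $M_Z = A_{Z_{m-1}} \cdots A_{Z_0}$.\<close>

definition word_mat :: "(letter \<Rightarrow> real ^ 'n ^ 'n) \<Rightarrow> letter list \<Rightarrow> real ^ 'n ^ 'n::finite" where
  "word_mat A Z = fold (\<lambda>s M. A s ** M) Z (mat 1)"

definition follows :: "'n \<Rightarrow> (real ^ 'n \<Rightarrow> real ^ 'n) \<Rightarrow> real ^ 'n::finite \<Rightarrow> letter list \<Rightarrow> bool" where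
  "follows k f x Z \<longleftrightarrow>
    (\<forall>i < length Z. ((f ^^ i) x $ k < 0 \<longrightarrow> Z ! i = L) \<and> ((f ^^ i) x $ k > 0 \<longrightarrow> Z ! i = R))"

text \<open>The tuple of points of a cycle is a list.\<close>

definition is_cycle ::
    "(letter \<Rightarrow> real ^ 'n ^ 'n) \<Rightarrow> real ^ 'n \<Rightarrow> letter list \<Rightarrow> (real ^ 'n::finite) list \<Rightarrow> bool" where
  "is_cycle A b Z xs \<longleftrightarrow>
    length xs = length Z \<and>
    (\<forall>i < length Z. f_aff A b (Z ! i) (xs ! i) = xs ! ((i + 1) mod length Z))"

definition admissible_cycle ::
    "(letter \<Rightarrow> real ^ 'n ^ 'n) \<Rightarrow> real ^ 'n \<Rightarrow> 'n \<Rightarrow> letter list \<Rightarrow> (real ^ 'n::finite) list \<Rightarrow> bool" where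
  "admissible_cycle A b k Z xs \<longleftrightarrow> is_cycle A b Z xs \<and> follows k (pwl A b k) (xs ! 0) Z"

text \<open>The bi-infinite symbol sequence $X^\infty Y X^\infty$, with $Y$ starting at index 0.\<close>

definition homoclinic_word :: "letter list \<Rightarrow> letter list \<Rightarrow> int \<Rightarrow> letter" where
  "homoclinic_word X Y i =
    (if i < 0 then X ! nat (i mod int (length X))
     else if i < int (length Y) then Y ! nat i
     else X ! nat ((i - int (length Y)) mod int (length X)))"

definition is_orbit ::
    "(letter \<Rightarrow> real ^ 'n ^ 'n) \<Rightarrow> real ^ 'n \<Rightarrow> (int \<Rightarrow> letter) \<Rightarrow> (int \<Rightarrow> real ^ 'n::finite) \<Rightarrow> bool" where
  "is_orbit A b S y \<longleftrightarrow> (\<forall>i. y (i + 1) = f_aff A b (S i) (y i))"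

definition admissible_orbit ::
    "(letter \<Rightarrow> real ^ 'n ^ 'n) \<Rightarrow> real ^ 'n \<Rightarrow> 'n \<Rightarrow> (int \<Rightarrow> letter) \<Rightarrow> (int \<Rightarrow> real ^ 'n::finite) \<Rightarrow> bool" where
  "admissible_orbit A b k S y \<longleftrightarrow>
    is_orbit A b S y \<and> (\<forall>i. (y i $ k < 0 \<longrightarrow> S i = L) \<and> (y i $ k > 0 \<longrightarrow> S i = R))"

definition homoclinic_to :: "(int \<Rightarrow> real ^ 'n::finite) \<Rightarrow> (real ^ 'n) list \<Rightarrow> bool" where
  "homoclinic_to y xs \<longleftrightarrow>
    ((\<lambda>i. infdist (y i) (set xs)) \<longlongrightarrow> 0) at_top \<and> ((\<lambda>i. infdist (y i) (set xs)) \<longlongrightarrow> 0) at_bot"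

text \<open>
  Eigenvalues of a real matrix are taken over the complex numbers; the multiplicity of an
  eigenvalue is its algebraic multiplicity.
\<close>

definition complexify :: "real ^ 'n ^ 'm \<Rightarrow> complex ^ 'n ^ 'm" where
  "complexify M = (\<chi> i j. complex_of_real (M $ i $ j))"

definition eigenvalues :: "real ^ 'n ^ 'n::finite \<Rightarrow> complex set" where
  "eigenvalues M = {\<mu>. \<exists>v. v \<noteq> 0 \<and> complexify M *v v = \<mu> *s v}"

definition charpoly :: "complex ^ 'n ^ 'n::finite \<Rightarrow> complex poly" where
  "charpoly M = det (mat [:0, 1:] - (\<chi> i j. [:M $ i $ j:]))"

definition multiplicity_one :: "real ^ 'n ^ 'n::finite \<Rightarrow> complex \<Rightarrow> bool" where
  "multiplicity_one M \<mu> \<longleftrightarrow> \<mu> \<in> eigenvalues M \<and> order \<mu> (charpoly (complexify M)) = 1"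

text \<open>
  Maximum modulus of the eigenvalues other than \<open>l1\<close> and \<open>l2\<close>. If \<open>l1\<close> and \<open>l2\<close> are distinct and
  have multiplicity one, the set of remaining eigenvalues is empty exactly if $N = 2$.
\<close>

definition remaining_modulus :: "real ^ 'n ^ 'n::finite \<Rightarrow> real \<Rightarrow> real \<Rightarrow> real" where
  "remaining_modulus M l1 l2 =
    (let E = eigenvalues M - {complex_of_real l1, complex_of_real l2}
     in if E = {} then 0 else Max (cmod ` E))"

text \<open>Here \<open>\<zeta>\<close> is an eigenvector for the unstable eigenvalue.\<close>

definition unstable_line :: "real ^ 'n \<Rightarrow> real ^ 'n \<Rightarrow> (real ^ 'n::finite) set" where
  "unstable_line x0 \<zeta> = {x0 + a *\<^sub>R \<zeta> | a. True}"

text \<open>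
  Unlike \<open>open_segment\<close>, these are the singleton \<open>{y}\<close> when the end points coincide in \<open>y\<close>.
\<close>

definition seg_co :: "real ^ 'n \<Rightarrow> real ^ 'n \<Rightarrow> (real ^ 'n::finite) set" where
  "seg_co y z = {(1 - s) *\<^sub>R y + s *\<^sub>R z | s. 0 \<le> s \<and> s < 1}"

definition seg_oo :: "real ^ 'n \<Rightarrow> real ^ 'n \<Rightarrow> (real ^ 'n::finite) set" where
  "seg_oo y z = {(1 - s) *\<^sub>R y + s *\<^sub>R z | s. 0 < s \<and> s < 1}"

definition stable_set :: "(real ^ 'n \<Rightarrow> real ^ 'n) \<Rightarrow> (real ^ 'n::finite) list \<Rightarrow> (real ^ 'n) set" where
  "stable_set f xs = {x. (\<lambda>i. infdist ((f ^^ i) x) (set xs)) \<longlonglongrightarrow> 0}"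

text \<open>
  The set \<open>W\<close> is the branch of the unstable manifold that leaves \<open>x0\<close> along the line
  \<open>unstable_line x0 \<zeta>\<close> on the side of its point \<open>q\<close>: for every \<open>z\<close> on that side and sufficiently
  close to \<open>x0\<close>, the forward images of the open segment from \<open>x0\<close> to \<open>z\<close> make up exactly \<open>W\<close>.
  If \<open>q \<noteq> x0\<close> is on the line, at most one \<open>W\<close> has this property.
\<close>

definition is_unstable_branch ::
    "(real ^ 'n \<Rightarrow> real ^ 'n) \<Rightarrow> real ^ 'n \<Rightarrow> real ^ 'n \<Rightarrow> real ^ 'n \<Rightarrow> (real ^ 'n::finite) set \<Rightarrow> bool" where
  "is_unstable_branch f x0 \<zeta> q W \<longleftrightarrow>
    (\<exists>\<epsilon> > 0. \<forall>z \<in> unstable_line x0 \<zeta>.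
       z \<noteq> x0 \<and> (\<exists>a > 0. z - x0 = a *\<^sub>R (q - x0)) \<and> dist x0 z < \<epsilon> \<longrightarrow>
       W = (\<Union>i. (f ^^ i) ` seg_oo x0 z))"

end

theory Submission
  imports Defs
begin

text \<open>
  Write \<open>n\<close> for the length of \<open>X\<close>, and \<open>S\<close> for the symbol sequence of the orbit \<open>y\<close>. The proof
  follows the pair \<open>(y i, y (i + n))\<close> under the map. Shifting \<open>S\<close> by \<open>n\<close> places changes it only
  where \<open>X @ Y\<close> and \<open>Y @ X\<close> differ, and at those two indices \<open>y (i + n)\<close> is \<open>y 0\<close> or \<open>y \<alpha>\<close>, a point of
  the switching manifold, where both affine pieces agree. Hence both ends of the segment from \<open>y i\<close> to
  \<open>y (i + n)\<close> lie in the same closed half-space, the map is affine on the segment, and it carries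
  segment \<open>i\<close> exactly onto segment \<open>i + 1\<close>, for every integer \<open>i\<close>
  (\<open>homoclinic_word_shift\<close>, \<open>pwl_image_seg\<close>).

  It remains to look at the two ends of time. Backwards, \<open>y (- j n)\<close> is
  \<open>x\<^sub>0 + l1\<^sup>-\<^sup>j (y\<^sub>0 - x\<^sub>0)\<close>, even if the matrix of \<open>X\<close> is singular
  (\<open>backward_orbit_from_zero_is_zero\<close>), so the segments with indices \<open>- (j + 1) n\<close> subdivide the
  open segment from \<open>x\<^sub>0\<close> to \<open>y\<^sub>0\<close> geometrically; forward images of a short initial piece
  therefore exhaust all segments (\<open>unstable_branch_of_segment_chain\<close>). Forwards, the points of
  the cycle are fixed by the continuous \<open>n\<close>-th iterate of the map, so \<open>y i\<close> and \<open>y (i + n)\<close> are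
  eventually close to the same point of the cycle, and with them the segment that joins them
  (\<open>segment_chain_in_stable_set\<close>).
\<close>

section \<open>Backward orbits of linear maps\<close>

text \<open>
  On the span of the orbit the map is surjective, since every orbit point is the image of the
  next one; finite dimension makes it injective there, and then zero has no preimage but zero.
\<close>

lemma backward_orbit_from_zero_is_zero:
  fixes g :: "'a::euclidean_space \<Rightarrow> 'a" and w :: "nat \<Rightarrow> 'a"
  assumes lin: "linear g" and start: "w 0 = 0" and step: "\<And>j. g (w (Suc j)) = w j"
  shows "w j = 0"
proof -
  define V where "V = span (range w)"
  have sub: "g ` range w \<subseteq> range w"
  proof clarify
    fix j show "g (w j) \<in> range w"
      by (cases j) (use step start linear_0[OF lin] in \<open>auto intro: range_eqI[of _ w 0]\<close>)
  qed
  have sup: "range w \<subseteq> g ` range w"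
    using step by (metis image_eqI image_subsetI rangeI)
  have onto: "g ` V = V"
    unfolding V_def using sub sup by (simp add: linear_span_image[OF lin, symmetric])
  obtain B where B: "B \<subseteq> V" "independent B" "V \<subseteq> span B" "card B = dim V"
    using basis_exists[of V] by blast
  have spanB: "span B = V"
    using B by (metis V_def span_minimal subspace_span subset_antisym)
  have fB: "finite B" using B independent_bound by blast
  have spangB: "span (g ` B) = V"
    using linear_span_image[OF lin] spanB onto by metis
  have "dim V \<le> card (g ` B)"
    using spangB fB by (metis dim_le_card dim_span finite_imageI order_refl)
  then have cardgB: "card (g ` B) = card B"
    using card_image_le[OF fB, of g] B(4) by linarith
  then have injB: "inj_on g B" using eq_card_imp_inj_on fB by blast
  have indgB: "independent (g ` B)"
    using card_le_dim_spanning[of "g ` B" V] spangB fB cardgB B(4)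
    by (metis finite_imageI order_refl span_superset)
  show ?thesis
  proof (induction j)
    case 0 show ?case by (rule start)
  next
    case (Suc j)
    have "w (Suc j) \<in> span B" unfolding spanB V_def by (simp add: span_base)
    moreover have "g (w (Suc j)) = 0" using step Suc by simp
    ultimately show ?case
      using linear_indep_image_lemma[OF lin fB indgB injB] by blast
  qed
qed

text \<open>
  A backward orbit that starts at an eigenvector is the obvious one: the difference of the two is
  a backward orbit of zero.
\<close>

lemma backward_orbit_from_eigenvector:
  fixes g :: "'a::euclidean_space \<Rightarrow> 'a" and v :: "nat \<Rightarrow> 'a"
  assumes lin: "linear g" and eig: "g (v 0) = l *\<^sub>R v 0" "l \<noteq> 0"
    and step: "\<And>j. g (v (Suc j)) = v j"
  shows "v j = (1 / l) ^ j *\<^sub>R v 0"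
proof -
  have "v j - (1 / l) ^ j *\<^sub>R v 0 = 0"
  proof (rule backward_orbit_from_zero_is_zero[OF lin, where w = "\<lambda>j. v j - (1 / l) ^ j *\<^sub>R v 0"])
    fix j
    show "g (v (Suc j) - (1 / l) ^ Suc j *\<^sub>R v 0) = v j - (1 / l) ^ j *\<^sub>R v 0"
      using eig by (simp add: linear_diff[OF lin] linear_cmul[OF lin] step)
  qed simp
  then show ?thesis by simp
qed

section \<open>Words, affine pieces and half-spaces\<close>

lemma fold_f_aff_diff:
  "fold (f_aff A b) Z u - fold (f_aff A b) Z v = word_mat A Z *v (u - v)"
proof (induction Z rule: rev_induct)
  case Nil
  then show ?case by (simp add: word_mat_def)
next
  case (snoc s Z)
  have "fold (f_aff A b) (Z @ [s]) u - fold (f_aff A b) (Z @ [s]) v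
      = A s *v (fold (f_aff A b) Z u - fold (f_aff A b) Z v)"
    by (simp add: f_aff_def matrix_vector_mult_diff_distrib)
  also have "\<dots> = word_mat A (Z @ [s]) *v (u - v)"
    by (simp add: snoc word_mat_def matrix_vector_mul_assoc)
  finally show ?case .
qed

lemma fold_along_orbit:
  assumes "\<And>j. j < length Z \<Longrightarrow> h (Z ! j) (u j) = u (Suc j)"
  shows "fold h Z (u 0) = u (length Z)"
  using assms
proof (induction Z rule: rev_induct)
  case Nil
  then show ?case by simp
next
  case (snoc s Z)
  have "fold h Z (u 0) = u (length Z)"
    using snoc.prems by (intro snoc.IH) (metis length_append_singleton less_Suc_eq nth_append)
  then show ?case using snoc.prems[of "length Z"] by simp
qed

lemma pwl_continuous:
  assumes "A R = A L + outer \<xi> (axis k 1)"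
  shows "continuous_on UNIV (pwl A b k)"
proof -
  have aff: "continuous_on S (f_aff A b s)" for s S
    unfolding f_aff_def
    by (intro continuous_intros linear_continuous_on linear_linear matrix_vector_mul_linear)
  have "continuous_on ({z. z $ k \<le> 0} \<union> {z. z $ k \<ge> 0})
      (\<lambda>z. if z $ k \<le> 0 then f_aff A b L z else f_aff A b R z)"
  proof (rule continuous_on_cases)
    show "\<forall>z. z \<in> {z. z $ k \<le> 0} \<and> \<not> z $ k \<le> 0 \<or> z \<in> {z. z $ k \<ge> 0} \<and> z $ k \<le> 0
        \<longrightarrow> f_aff A b L z = f_aff A b R z"
    proof (intro allI impI)
      fix z :: "real^'a"
      assume "z \<in> {z. z $ k \<le> 0} \<and> \<not> z $ k \<le> 0 \<or> z \<in> {z. z $ k \<ge> 0} \<and> z $ k \<le> 0"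
      then have "z $ k = 0" by auto
      then show "f_aff A b L z = f_aff A b R z"
        using pwl_R[OF assms, of z b] by (simp add: pwl_def)
    qed
    show "closed {z::real^'a. z $ k \<le> 0}" "closed {z::real^'a. z $ k \<ge> 0}"
      by (intro closed_Collect_le continuous_intros)+
  qed (rule aff)+
  moreover have "{z::real^'a. z $ k \<le> 0} \<union> {z. z $ k \<ge> 0} = UNIV" by auto
  ultimately show ?thesis by (simp add: pwl_def[abs_def])
qed

text \<open>
  The condition that admissible orbits and cycles satisfy at each index. It describes a closed
  half-space, hence is convex, and on the switching manifold it holds for both letters.
\<close>

definition admits :: "'n \<Rightarrow> letter \<Rightarrow> real ^ 'n::finite \<Rightarrow> bool" where
  "admits k s z \<longleftrightarrow> (z $ k < 0 \<longrightarrow> s = L) \<and> (z $ k > 0 \<longrightarrow> s = R)"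

lemma pwl_eq_f_aff:
  assumes "A R = A L + outer \<xi> (axis k 1)" and "admits k s z"
  shows "pwl A b k z = f_aff A b s z"
  using assms pwl_R[OF assms(1), of z b]
  by (cases s; cases "z $ k" "0::real" rule: linorder_cases) (auto simp: admits_def pwl_def)

lemma admits_seg:
  assumes "admits k s u" "admits k s v" "z \<in> seg_co u v"
  shows "admits k s z"
proof -
  obtain t where t: "z = (1 - t) *\<^sub>R u + t *\<^sub>R v" "0 \<le> t" "t < 1"
    using assms(3) by (auto simp: seg_co_def)
  have z: "z $ k = (1 - t) * u $ k + t * v $ k" using t(1) by simp
  show ?thesis
  proof (cases s)
    case L
    then have "u $ k \<le> 0" "v $ k \<le> 0"
      using assms(1,2) by (auto simp: admits_def not_less[symmetric])
    then have "(1 - t) * u $ k \<le> 0" "t * v $ k \<le> 0"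
      using t(2,3) by (auto simp: mult_nonneg_nonpos)
    then show ?thesis using L z by (simp add: admits_def)
  next
    case R
    then have "u $ k \<ge> 0" "v $ k \<ge> 0"
      using assms(1,2) by (auto simp: admits_def not_less[symmetric])
    then have "(1 - t) * u $ k \<ge> 0" "t * v $ k \<ge> 0"
      using t(2,3) by auto
    then show ?thesis using R z by (simp add: admits_def)
  qed
qed

lemma f_aff_combination:
  "f_aff A b s ((1 - t) *\<^sub>R u + t *\<^sub>R v) = (1 - t) *\<^sub>R f_aff A b s u + t *\<^sub>R f_aff A b s v"
  by (simp add: f_aff_def matrix_vector_right_distrib matrix_vector_mult_scaleR algebra_simps)

lemma f_aff_image_seg: "f_aff A b s ` seg_co u v = seg_co (f_aff A b s u) (f_aff A b s v)"
proof -
  have seg: "seg_co p q = (\<lambda>t. (1 - t) *\<^sub>R p + t *\<^sub>R q) ` {0..<1}" for p q :: "real^'a"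
    by (auto simp: seg_co_def)
  show ?thesis
    unfolding seg image_image f_aff_combination ..
qed

lemma pwl_image_seg:
  assumes "A R = A L + outer \<xi> (axis k 1)" and "admits k s u" "admits k s v"
  shows "pwl A b k ` seg_co u v = seg_co (pwl A b k u) (pwl A b k v)"
proof -
  have "pwl A b k ` seg_co u v = f_aff A b s ` seg_co u v"
    using admits_seg[OF assms(2,3)] pwl_eq_f_aff[OF assms(1)] by (intro image_cong) auto
  then show ?thesis
    using assms by (simp add: f_aff_image_seg pwl_eq_f_aff)
qed

text \<open>
  On the window of indices from \<open>- length X\<close> to \<open>length Y - 1\<close> the sequence reads \<open>X @ Y\<close> and the
  shifted one reads \<open>Y @ X\<close>; outside of it, both read the same periodic continuation of \<open>X\<close>.
\<close>

lemma homoclinic_word_shift: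
  fixes i :: int
  assumes words: "X @ Y = flip_at \<alpha> (flip_at 0 (Y @ X))" and X: "X \<noteq> []"
    and i: "i + int (length X) \<noteq> 0" "i + int (length X) \<noteq> int \<alpha>"
  shows "homoclinic_word X Y (i + int (length X)) = homoclinic_word X Y i"
proof -
  let ?n = "int (length X)" and ?p = "int (length Y)"
  have n: "?n > 0" using X by simp
  consider "i + ?n < 0" | "i \<ge> ?p" | "0 \<le> i + ?n" "i < ?p" by linarith
  then show ?thesis
  proof cases
    case 1
    then show ?thesis using n by (simp add: homoclinic_word_def)
  next
    case 2
    then have "(i + ?n - ?p) mod ?n = (i - ?p) mod ?n"
      by (metis add_diff_eq diff_add_eq mod_add_self2)
    then show ?thesis using 2 n by (simp add: homoclinic_word_def)
  next
    case 3
    define j where "j = nat (i + ?n)"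
    have ij: "i = int j - ?n" and j: "j \<noteq> 0" "j \<noteq> \<alpha>" "j < length X + length Y"
      using 3 i by (auto simp: j_def)
    have same: "(X @ Y) ! j = (Y @ X) ! j"
      using words j by (simp add: flip_at_def)
    have left: "homoclinic_word X Y i = (X @ Y) ! j"
    proof (cases "i < 0")
      case True
      have "i mod ?n = (i + ?n) mod ?n" by simp
      also have "\<dots> = i + ?n" using 3 True by (intro mod_pos_pos_trivial) auto
      finally have "i mod ?n = int j" using ij by simp
      then show ?thesis using True ij by (simp add: homoclinic_word_def nth_append)
    next
      case False
      then have "nat i = j - length X" "\<not> j < length X" using ij by auto
      then show ?thesis using False 3 by (simp add: homoclinic_word_def nth_append)
    qed
    have right: "homoclinic_word X Y (i + ?n) = (Y @ X) ! j"
    proof (cases "j < length Y")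
      case True
      then show ?thesis using ij by (simp add: homoclinic_word_def nth_append)
    next
      case False
      then have "(int j - ?p) mod ?n = int j - ?p"
        using j by (intro mod_pos_pos_trivial) auto
      then have "nat ((int j - ?p) mod ?n) = j - length Y" by simp
      then show ?thesis using ij False by (simp add: homoclinic_word_def nth_append)
    qed
    show ?thesis using left right same by simp
  qed
qed

lemma admissible_cycle_iterate:
  assumes continuity: "A R = A L + outer \<xi> (axis k 1)"
    and cycle: "admissible_cycle A b k X x" and j: "j < length X"
  shows "(pwl A b k ^^ j) (x ! 0) = x ! j"
    and "pwl A b k (x ! j) = x ! ((j + 1) mod length X)"
proof -
  have step: "pwl A b k (x ! j) = x ! ((j + 1) mod length X)"
    if "(pwl A b k ^^ j) (x ! 0) = x ! j" "j < length X" for j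
  proof -
    have "admits k (X ! j) (x ! j)"
      using cycle that by (metis admissible_cycle_def follows_def admits_def)
    then show ?thesis
      using pwl_eq_f_aff[OF continuity] cycle that(2)
      by (simp add: admissible_cycle_def is_cycle_def)
  qed
  show it: "(pwl A b k ^^ j) (x ! 0) = x ! j" using j
  proof (induction j)
    case 0
    then show ?case by simp
  next
    case (Suc j)
    then show ?case using step[of j] by simp
  qed
  show "pwl A b k (x ! j) = x ! ((j + 1) mod length X)"
    by (rule step[OF it j])
qed

lemma admissible_cycle_periodic:
  assumes continuity: "A R = A L + outer \<xi> (axis k 1)"
    and cycle: "admissible_cycle A b k X x" and c: "c \<in> set x"
  shows "(pwl A b k ^^ length X) c = c"
proof -
  have len: "length x = length X" using cycle by (simp add: admissible_cycle_def is_cycle_def)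
  obtain r where r: "r < length X" "c = x ! r" using c len by (metis in_set_conv_nth)
  have "(pwl A b k ^^ m) (x ! r) = x ! ((r + m) mod length X)" for m
  proof (induction m)
    case 0
    then show ?case using r by simp
  next
    case (Suc m)
    have "(r + m) mod length X < length X" by (rule mod_less_divisor) (use r in linarith)
    then show ?case
      using admissible_cycle_iterate(2)[OF continuity cycle] Suc by (simp add: mod_Suc_eq)
  qed
  from this[of "length X"] show ?thesis using r by simp
qed

section \<open>Chains of segments\<close>

lemma seg_co_on_ray:
  assumes "a < b"
  shows "seg_co (p + a *\<^sub>R d) (p + b *\<^sub>R d) = (\<lambda>t. p + t *\<^sub>R d) ` {a..<b}"
proof (intro equalityI subsetI)
  fix z assume "z \<in> seg_co (p + a *\<^sub>R d) (p + b *\<^sub>R d)"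
  then obtain s where s: "0 \<le> s" "s < 1"
      "z = (1 - s) *\<^sub>R (p + a *\<^sub>R d) + s *\<^sub>R (p + b *\<^sub>R d)"
    by (auto simp: seg_co_def)
  have "z = p + (a + s * (b - a)) *\<^sub>R d" using s(3) by (simp add: algebra_simps)
  moreover have "s * (b - a) \<ge> 0" "s * (b - a) < 1 * (b - a)"
    using s assms by (auto intro: mult_strict_right_mono)
  ultimately show "z \<in> (\<lambda>t. p + t *\<^sub>R d) ` {a..<b}"
    by (intro image_eqI[of _ _ "a + s * (b - a)"]) auto
next
  fix z assume "z \<in> (\<lambda>t. p + t *\<^sub>R d) ` {a..<b}"
  then obtain t where t: "a \<le> t" "t < b" "z = p + t *\<^sub>R d" by auto
  define s where "s = (t - a) / (b - a)"
  have s: "0 \<le> s" "s < 1" using t assms by (auto simp: s_def)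
  have "s * (b - a) = t - a" using assms by (simp add: s_def)
  then have "t = a + s * (b - a)" by simp
  then have "z = p + (a + s * (b - a)) *\<^sub>R d" using t(3) by simp
  then have "z = (1 - s) *\<^sub>R (p + a *\<^sub>R d) + s *\<^sub>R (p + b *\<^sub>R d)"
    by (simp add: algebra_simps)
  then show "z \<in> seg_co (p + a *\<^sub>R d) (p + b *\<^sub>R d)" using s by (auto simp: seg_co_def)
qed

lemma seg_oo_on_ray:
  assumes "0 < a"
  shows "seg_oo p (p + a *\<^sub>R d) = (\<lambda>t. p + t *\<^sub>R d) ` {0<..<a}"
proof (intro equalityI subsetI)
  fix z assume "z \<in> seg_oo p (p + a *\<^sub>R d)"
  then obtain s where s: "0 < s" "s < 1" "z = (1 - s) *\<^sub>R p + s *\<^sub>R (p + a *\<^sub>R d)"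
    by (auto simp: seg_oo_def)
  have "z = p + (s * a) *\<^sub>R d" using s(3) by (simp add: algebra_simps)
  moreover have "s * a > 0" "s * a < 1 * a"
    using s assms by (auto intro: mult_strict_right_mono)
  ultimately show "z \<in> (\<lambda>t. p + t *\<^sub>R d) ` {0<..<a}"
    by (intro image_eqI[of _ _ "s * a"]) auto
next
  fix z assume "z \<in> (\<lambda>t. p + t *\<^sub>R d) ` {0<..<a}"
  then obtain t where t: "0 < t" "t < a" "z = p + t *\<^sub>R d" by auto
  have "z = (1 - t / a) *\<^sub>R p + (t / a) *\<^sub>R (p + a *\<^sub>R d)"
    using t(3) assms by (simp add: algebra_simps)
  then show "z \<in> seg_oo p (p + a *\<^sub>R d)" using t assms by (auto simp: seg_oo_def)
qed

lemma geometric_subdivision: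
  fixes t \<mu> :: real
  assumes "0 < t" "t < 1" "\<mu> < 1"
  shows "\<exists>j. \<mu> ^ Suc j \<le> t \<and> t < \<mu> ^ j"
proof -
  obtain m where m: "\<mu> ^ m < t"
    using real_arch_pow_inv[OF assms(1,3)] by blast
  define m0 where "m0 = (LEAST m. \<mu> ^ m \<le> t)"
  have le: "\<mu> ^ m0 \<le> t" unfolding m0_def by (rule LeastI[of _ m]) (use m in simp)
  then obtain j where j: "m0 = Suc j" using assms(2) by (cases m0) auto
  have "\<not> \<mu> ^ j \<le> t" using not_less_Least[of j "\<lambda>m. \<mu> ^ m \<le> t"] j by (simp add: m0_def)
  then show ?thesis using le j by auto
qed

lemma funpow_image_seg_chain:
  fixes y :: "int \<Rightarrow> real ^ 'n::finite"
  assumes "\<And>i. f ` seg_co (y i) (y (i + n)) = seg_co (y (i + 1)) (y (i + 1 + n))"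
  shows "(f ^^ m) ` seg_co (y i) (y (i + n)) = seg_co (y (i + int m)) (y (i + int m + n))"
proof (induction m)
  case 0
  then show ?case by simp
next
  case (Suc m)
  have "(f ^^ Suc m) ` seg_co (y i) (y (i + n)) = f ` (f ^^ m) ` seg_co (y i) (y (i + n))"
    by (simp add: image_comp)
  then show ?case
    using Suc assms[of "i + int m"] by (simp add: algebra_simps)
qed

text \<open>
  The segments with indices \<open>- (j + 1) n\<close> tile the open segment from \<open>x0\<close> to \<open>y 0\<close>. Every initial
  piece of it contains those with large \<open>j\<close>, and any given segment is a forward image of one of
  them.
\<close>

lemma unstable_branch_of_segment_chain:
  fixes y :: "int \<Rightarrow> real ^ 'n::finite"
  assumes chain: "\<And>i. f ` seg_co (y i) (y (i + int n)) = seg_co (y (i + 1)) (y (i + 1 + int n))"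
    and n: "n > 0" and \<mu>: "0 < \<mu>" "\<mu> < 1"
    and geom: "\<And>j. y (- int j * int n) = x0 + \<mu> ^ j *\<^sub>R (y 0 - x0)"
    and ne: "y 0 \<noteq> x0"
  shows "is_unstable_branch f x0 \<zeta> (y 0) (\<Union>i. seg_co (y i) (y (i + int n)))"
proof -
  let ?W = "\<Union>i. seg_co (y i) (y (i + int n))"
  define ray where "ray t = x0 + t *\<^sub>R (y 0 - x0)" for t
  note iter = funpow_image_seg_chain[of f y "int n", OF chain]
  have tile: "seg_co (y (- int (Suc j) * int n)) (y (- int (Suc j) * int n + int n))
      = ray ` {\<mu> ^ Suc j..<\<mu> ^ j}" for j
  proof -
    have "- int (Suc j) * int n + int n = - int j * int n" by (simp add: algebra_simps)
    moreover have "\<mu> ^ Suc j < \<mu> ^ j" using \<mu> by simp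
    ultimately show ?thesis
      using seg_co_on_ray[of "\<mu> ^ Suc j" "\<mu> ^ j" x0 "y 0 - x0"]
      by (simp only: geom ray_def[abs_def])
  qed
  have main: "?W = (\<Union>i. (f ^^ i) ` seg_oo x0 z)"
    if z: "z - x0 = a *\<^sub>R (y 0 - x0)" "a > 0" "dist x0 z < dist x0 (y 0)" for z a
  proof -
    have "dist x0 z = a * dist x0 (y 0)"
      using z(1,2) by (metis abs_of_pos dist_commute dist_norm norm_scaleR)
    then have a1: "a < 1" using z(3) ne by simp
    have "z = x0 + a *\<^sub>R (y 0 - x0)" using z(1) by (metis add.commute diff_add_cancel)
    then have seg: "seg_oo x0 z = ray ` {0<..<a}"
      using seg_oo_on_ray[OF z(2), of x0 "y 0 - x0"] by (simp add: ray_def[abs_def])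
    show ?thesis
    proof (intro equalityI subsetI)
      fix w assume "w \<in> (\<Union>i. (f ^^ i) ` seg_oo x0 z)"
      then obtain m t where t: "0 < t" "t < a" "w = (f ^^ m) (ray t)" using seg by auto
      then obtain j where "\<mu> ^ Suc j \<le> t" "t < \<mu> ^ j"
        using geometric_subdivision[of t \<mu>] a1 \<mu> by auto
      then have "w \<in> (f ^^ m) `
          seg_co (y (- int (Suc j) * int n)) (y (- int (Suc j) * int n + int n))"
        unfolding tile t(3) by auto
      then show "w \<in> ?W" unfolding iter by blast
    next
      fix w assume "w \<in> ?W"
      then obtain i where i: "w \<in> seg_co (y i) (y (i + int n))" by blast
      obtain j0 where j0: "\<mu> ^ j0 < a" using real_arch_pow_inv[OF z(2) \<mu>(2)] by blast
      \<comment> \<open>Far enough back to lie in the initial piece and to precede index \<open>i\<close>.\<close>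
      define j where "j = j0 + nat \<bar>i\<bar>"
      define m where "m = nat (i + int (Suc j) * int n)"
      have "\<mu> ^ j \<le> \<mu> ^ j0" using \<mu> by (intro power_decreasing) (auto simp: j_def)
      moreover have "\<mu> ^ Suc j > 0" using \<mu> by simp
      ultimately have "{\<mu> ^ Suc j..<\<mu> ^ j} \<subseteq> {0<..<a}"
        using j0 unfolding subset_iff atLeastLessThan_iff greaterThanLessThan_iff by linarith
      then have sub: "seg_co (y (- int (Suc j) * int n)) (y (- int (Suc j) * int n + int n))
          \<subseteq> seg_oo x0 z"
        unfolding tile seg by (rule image_mono)
      have bound: "0 \<le> i + q" if "\<bar>i\<bar> \<le> r" "r \<le> q" for q r using that by linarith
      have "0 \<le> i + int (Suc j) * int n"
      proof (rule bound)
        show "\<bar>i\<bar> \<le> int (Suc j)" by (simp add: j_def)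
        show "int (Suc j) \<le> int (Suc j) * int n" using n by (simp only: mult_le_cancel_left1) simp
      qed
      then have "- int (Suc j) * int n + int m = i"
        unfolding m_def by (simp add: algebra_simps)
      then have "w \<in> (f ^^ m) `
          seg_co (y (- int (Suc j) * int n)) (y (- int (Suc j) * int n + int n))"
        using i by (simp only: iter)
      then have "w \<in> (f ^^ m) ` seg_oo x0 z" using image_mono[OF sub] by (rule rev_subsetD)
      then show "w \<in> (\<Union>i. (f ^^ i) ` seg_oo x0 z)" by (rule UN_I[OF UNIV_I])
    qed
  qed
  show ?thesis
    unfolding is_unstable_branch_def
  proof (intro exI[of _ "dist x0 (y 0)"] conjI ballI impI)
    show "dist x0 (y 0) > 0" using ne by simp
  next
    fix z
    assume "z \<noteq> x0 \<and> (\<exists>a>0. z - x0 = a *\<^sub>R (y 0 - x0)) \<and> dist x0 z < dist x0 (y 0)"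
    then obtain a where "a > 0" "z - x0 = a *\<^sub>R (y 0 - x0)" "dist x0 z < dist x0 (y 0)"
      by (elim conjE exE)
    then show "?W = (\<Union>i. (f ^^ i) ` seg_oo x0 z)" by (intro main)
  qed
qed

text \<open>
  The \<open>n\<close>-th iterate is continuous and fixes the points of \<open>xs\<close>, so once \<open>y i\<close> is close to one of
  them, \<open>y (i + n)\<close> is close to the same one. Balls are convex, so the segment between the two is
  close to it as well; as \<open>xs\<close> is finite, one tolerance serves all its points.
\<close>

lemma segment_chain_in_stable_set:
  fixes y :: "int \<Rightarrow> real ^ 'n::finite" and f :: "real ^ 'n \<Rightarrow> real ^ 'n"
  assumes chain: "\<And>i. f ` seg_co (y i) (y (i + int n)) = seg_co (y (i + 1)) (y (i + 1 + int n))"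
    and cont: "continuous_on UNIV f" and xs: "xs \<noteq> []"
    and fixed: "\<And>c. c \<in> set xs \<Longrightarrow> (f ^^ n) c = c"
    and orbit: "\<And>i. y (i + int n) = (f ^^ n) (y i)"
    and lim: "((\<lambda>i. infdist (y i) (set xs)) \<longlongrightarrow> 0) at_top"
  shows "(\<Union>i. seg_co (y i) (y (i + int n))) \<subseteq> stable_set f xs"
proof clarify
  fix i w assume w: "w \<in> seg_co (y i) (y (i + int n))"
  have contn: "continuous_on UNIV (f ^^ m)" for m
  proof (induction m)
    case (Suc m)
    then have "continuous_on UNIV (f \<circ> f ^^ m)"
      by (rule continuous_on_compose) (rule continuous_on_subset[OF cont subset_UNIV])
    then show ?case by simp
  qed simp
  have "\<forall>\<^sub>F m in sequentially. dist (infdist ((f ^^ m) w) (set xs)) 0 < e" if e: "e > 0" for e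
  proof -
    have "\<exists>d>0. \<forall>v. dist v c < d \<longrightarrow> dist ((f ^^ n) v) c < e" if "c \<in> set xs" for c
      using contn[of n] fixed[OF that] e unfolding continuous_on_iff by (metis UNIV_I)
    then obtain d where d: "\<And>c. c \<in> set xs \<Longrightarrow> d c > 0"
        "\<And>c v. c \<in> set xs \<Longrightarrow> dist v c < d c \<Longrightarrow> dist ((f ^^ n) v) c < e" by metis
    define \<delta> where "\<delta> = Min (insert e (d ` set xs))"
    have \<delta>: "\<delta> > 0" "\<delta> \<le> e" "\<And>c. c \<in> set xs \<Longrightarrow> \<delta> \<le> d c"
      using d(1) e by (auto simp: \<delta>_def)
    have "\<forall>\<^sub>F i in at_top. infdist (y i) (set xs) < \<delta>"
      using order_tendstoD(2)[OF lim \<delta>(1)] .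
    then obtain I where I: "\<And>i. i \<ge> I \<Longrightarrow> infdist (y i) (set xs) < \<delta>"
      by (auto simp: eventually_at_top_linorder)
    have near: "infdist v (set xs) < e" if i: "i \<ge> I" and v: "v \<in> seg_co (y i) (y (i + int n))" for i v
    proof -
      obtain c where c: "c \<in> set xs" "dist (y i) c < \<delta>"
        using I[OF i] xs infdist_notempty[of "set xs" "y i"]
        by (auto simp: cINF_less_iff bdd_below_finite)
      have ends: "y i \<in> ball c e" "y (i + int n) \<in> ball c e"
        using c \<delta> d(2)[OF c(1), of "y i"] orbit[of i]
        by (auto simp: dist_commute intro: less_le_trans)
      have "v \<in> closed_segment (y i) (y (i + int n))"
        using v by (auto simp: seg_co_def closed_segment_def)
      then have "v \<in> ball c e" using ends closed_segment_subset[OF _ _ convex_ball] by blast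
      then show ?thesis using infdist_le[OF c(1), of v] by (simp add: dist_commute)
    qed
    have "dist (infdist ((f ^^ m) w) (set xs)) 0 < e" if "m \<ge> nat (I - i)" for m
    proof -
      have "(f ^^ m) w \<in> seg_co (y (i + int m)) (y (i + int m + int n))"
        using w funpow_image_seg_chain[of f y "int n", OF chain] by blast
      then show ?thesis using near[of "i + int m"] that by (simp add: infdist_nonneg)
    qed
    then show ?thesis by (auto simp: eventually_sequentially)
  qed
  then show "w \<in> stable_set f xs" by (simp add: stable_set_def tendsto_iff)
qed

section \<open>The unstable branch is the chain of segments\<close>

theorem proposition4p1:
  fixes A :: "letter \<Rightarrow> real ^ 'n ^ 'n::finite" and b \<xi> \<zeta>1 :: "real ^ 'n" and k :: 'n
    and X Y :: "letter list" and \<alpha> :: nat and l1 l2 :: real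
    and x :: "(real ^ 'n) list" and y :: "int \<Rightarrow> real ^ 'n"
  assumes continuity: "A R = A L + outer \<xi> (axis k 1)"
    and alpha: "\<alpha> \<in> {1..length X + length Y - 1}"
    and words: "X @ Y = flip_at \<alpha> (flip_at 0 (Y @ X))"
    and eig1: "multiplicity_one (word_mat A X) (complex_of_real l1)"
    and eig2: "multiplicity_one (word_mat A X) (complex_of_real l2)"
    and spectrum: "0 \<le> remaining_modulus (word_mat A X) l1 l2"
      "remaining_modulus (word_mat A X) l1 l2 < l2" "l2 < 1" "1 < l1"
    and eigvec: "\<zeta>1 \<noteq> 0" "word_mat A X *v \<zeta>1 = l1 *\<^sub>R \<zeta>1"
    and transversal: "\<zeta>1 $ k \<noteq> 0"
    and cycle: "admissible_cycle A b k X x" "x ! 0 \<notin> switching_manifold k"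
    and orbit: "admissible_orbit A b k (homoclinic_word X Y) y"
    and homoclinic: "homoclinic_to y x"
    and y0: "{y 0} = unstable_line (x ! 0) \<zeta>1 \<inter> switching_manifold k"
    and y\<alpha>: "y (int \<alpha>) \<in> switching_manifold k"
  shows "is_unstable_branch (pwl A b k) (x ! 0) \<zeta>1 (y 0)
           (\<Union>i. seg_co (y i) (y (i + int (length X))))
       \<and> (\<Union>i. seg_co (y i) (y (i + int (length X)))) \<subseteq> stable_set (pwl A b k) x"
proof -
  define f where "f = pwl A b k"
  define S where "S = homoclinic_word X Y"
  let ?n = "length X"
  \<comment> \<open>The empty word has the identity matrix, whose only eigenvalue is 1.\<close>
  have X: "X \<noteq> []"
  proof
    assume "X = []"
    then have "\<zeta>1 = l1 *\<^sub>R \<zeta>1" using eigvec(2) by (simp add: word_mat_def)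
    then have "(l1 - 1) *\<^sub>R \<zeta>1 = 0" by (simp add: scaleR_left_diff_distrib)
    then show False using eigvec(1) spectrum(4) by simp
  qed
  have step: "y (i + 1) = f_aff A b (S i) (y i)" for i
    using orbit by (simp add: admissible_orbit_def is_orbit_def S_def)
  have adm: "admits k (S i) (y i)" for i
    using orbit by (simp add: admissible_orbit_def admits_def S_def)
  have f_y: "f (y i) = y (i + 1)" for i
    using pwl_eq_f_aff[OF continuity adm] step by (simp add: f_def)
  have "y 0 \<in> switching_manifold k" using y0 by blast
  then have crossing: "y 0 $ k = 0" "y (int \<alpha>) $ k = 0"
    using y\<alpha> by (auto simp: switching_manifold_def)

  have adm_shift: "admits k (S i) (y (i + int ?n))" for i
  proof (cases "i + int ?n = 0 \<or> i + int ?n = int \<alpha>")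
    case True
    then show ?thesis using crossing by (auto simp: admits_def)
  next
    case False
    then have "S (i + int ?n) = S i"
      using homoclinic_word_shift[OF words X] by (simp add: S_def)
    then show ?thesis using adm by metis
  qed
  have chain: "f ` seg_co (y i) (y (i + int ?n)) = seg_co (y (i + 1)) (y (i + 1 + int ?n))" for i
    using pwl_image_seg[OF continuity adm adm_shift, of b i] f_y[of i] f_y[of "i + int ?n"]
    by (simp add: f_def algebra_simps)

  have len: "length x = ?n" using cycle by (simp add: admissible_cycle_def is_cycle_def)
  have fixed: "fold (f_aff A b) X (x ! 0) = x ! 0"
  proof -
    have "fold (f_aff A b) X (x ! (0 mod ?n)) = x ! (?n mod ?n)"
      using cycle by (intro fold_along_orbit[of X _ "\<lambda>j. x ! (j mod ?n)"])
        (auto simp: admissible_cycle_def is_cycle_def)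
    then show ?thesis by simp
  qed
  have period: "fold (f_aff A b) X (y (- int (Suc j) * int ?n)) = y (- int j * int ?n)" for j
  proof -
    let ?i = "- int (Suc j) * int ?n"
    have "fold (f_aff A b) X (y (?i + int 0)) = y (?i + int ?n)"
    proof (rule fold_along_orbit[of X _ "\<lambda>r. y (?i + int r)"])
      fix r assume r: "r < ?n"
      have "int ?n \<le> int (Suc j) * int ?n" by (simp add: algebra_simps)
      then have "?i + int r < 0" using r by linarith
      moreover have "(?i + int r) mod int ?n = int r"
      proof -
        have "(?i + int r) mod int ?n = (int r + (- int (Suc j)) * int ?n) mod int ?n"
          by (simp only: add.commute)
        also have "\<dots> = int r mod int ?n" by (rule mod_mult_self1)
        finally show ?thesis using r by simp
      qed
      ultimately have "S (?i + int r) = X ! r" by (simp only: S_def homoclinic_word_def) simp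
      then show "f_aff A b (X ! r) (y (?i + int r)) = y (?i + int (Suc r))"
        using step[of "?i + int r"] by (simp add: algebra_simps)
    qed
    then show ?thesis by (simp add: algebra_simps)
  qed
  have "y 0 \<in> unstable_line (x ! 0) \<zeta>1" using y0 by blast
  then obtain c where c: "y 0 = x ! 0 + c *\<^sub>R \<zeta>1" by (auto simp: unstable_line_def)
  have geom: "y (- int j * int ?n) = x ! 0 + (1 / l1) ^ j *\<^sub>R (y 0 - x ! 0)" for j
  proof -
    let ?v = "\<lambda>j. y (- int j * int ?n) - x ! 0"
    have "?v j = (1 / l1) ^ j *\<^sub>R ?v 0"
    proof (rule backward_orbit_from_eigenvector[where v = ?v and g = "(*v) (word_mat A X)"])
      show "word_mat A X *v ?v 0 = l1 *\<^sub>R ?v 0"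
        using eigvec(2) by (simp add: c matrix_vector_mult_scaleR)
      show "word_mat A X *v ?v (Suc j) = ?v j" for j
        using fold_f_aff_diff[of A b X "y (- int (Suc j) * int ?n)" "x ! 0"] period[of j] fixed
        by simp
    qed (use spectrum in auto)
    then show ?thesis by (simp add: algebra_simps)
  qed
  have "y 0 \<noteq> x ! 0"
    using cycle(2) crossing by (auto simp: switching_manifold_def)
  then have branch: "is_unstable_branch f (x ! 0) \<zeta>1 (y 0) (\<Union>i. seg_co (y i) (y (i + int ?n)))"
    using unstable_branch_of_segment_chain[of f y ?n "1 / l1" "x ! 0" \<zeta>1, OF chain _ _ _ geom]
      X spectrum(4) by simp

  have iter: "(f ^^ m) (y i) = y (i + int m)" for m i
    by (induction m) (simp_all add: f_y algebra_simps)
  have "(\<Union>i. seg_co (y i) (y (i + int ?n))) \<subseteq> stable_set f x"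
  proof (rule segment_chain_in_stable_set[OF chain])
    show "continuous_on UNIV f" unfolding f_def by (rule pwl_continuous[OF continuity])
    show "x \<noteq> []" using X len by auto
    show "(f ^^ ?n) c = c" if "c \<in> set x" for c
      unfolding f_def by (rule admissible_cycle_periodic[OF continuity cycle(1) that])
    show "y (i + int ?n) = (f ^^ ?n) (y i)" for i by (simp add: iter)
    show "((\<lambda>i. infdist (y i) (set x)) \<longlongrightarrow> 0) at_top"
      using homoclinic by (simp add: homoclinic_to_def)
  qed
  with branch show ?thesis by (simp add: f_def)
qed

end
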